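(* The generating function $A(x)=\sum_{n\geq0}a_n(312,4321:231)x^n$ is given by \[A(x)=\frac{1}{1-x-x^2-2x^3-3x^4-2x^5}.\]
   Context: $\mathcal{S}_n$ is the set of permutations of $\{1,\ldots,n\}$ in one-line form; $\pi^2=\pi\circ\pi$. A permutation contains a pattern $\sigma\in\mathcal{S}_k$ if some subsequence of it (not necessarily consecutive) has the same relative order as $\sigma$; otherwise it avoids $\sigma$. $a_n(312,4321:\sigma)$ is the number of $\pi\in\mathcal{S}_n$ such that $\pi$ avoids both $312$ and $4321$ and $\pi^2$ avoids $\sigma$; $\mathcal{S}_0$ consists of the empty permutation, so $a_0=1$. The identity is one of formal power series. *)

theory Defs
  imports
    "HOL-Combinatorics.Permutations"
    "HOL-Library.Sublist"
    "HOL-Computational_Algebra.Formal_Power_Series"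
begin

definition one_line :: "nat \<Rightarrow> (nat \<Rightarrow> nat) \<Rightarrow> nat list" where
  "one_line n \<pi> = map \<pi> [1..<Suc n]"

definition same_relative_order :: "nat list \<Rightarrow> nat list \<Rightarrow> bool" where
  "same_relative_order u v \<longleftrightarrow> length u = length v \<and>
     (\<forall>i<length u. \<forall>j<length u. u ! i < u ! j \<longleftrightarrow> v ! i < v ! j)"

(* subseq is the library's relation for not necessarily consecutive subsequences *)
definition contains_pattern :: "nat list \<Rightarrow> nat list \<Rightarrow> bool" where
  "contains_pattern w \<sigma> \<longleftrightarrow> (\<exists>s. subseq s w \<and> same_relative_order s \<sigma>)"

abbreviation avoids :: "nat list \<Rightarrow> nat list \<Rightarrow> bool" where
  "avoids w \<sigma> \<equiv> \<not> contains_pattern w \<sigma>"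

(* T is the set of patterns avoided by \<pi> itself, and \<sigma> the pattern avoided by its square;
   all patterns are in one-line form. A function permuting {1..n} fixes every number outside
   {1..n}, so each element of S_n is counted once, and for n = 0 only the identity is counted. *)
definition avoiders :: "nat \<Rightarrow> nat list set \<Rightarrow> nat list \<Rightarrow> (nat \<Rightarrow> nat) set" where
  "avoiders n T \<sigma> = {\<pi>. \<pi> permutes {1..n} \<and>
     (\<forall>\<tau>\<in>T. avoids (one_line n \<pi>) \<tau>) \<and> avoids (one_line n (\<pi> \<circ> \<pi>)) \<sigma>}"

definition num_avoiders :: "nat \<Rightarrow> nat list set \<Rightarrow> nat list \<Rightarrow> nat" where
  "num_avoiders n T \<sigma> = card (avoiders n T \<sigma>)"

end

theory Submission
  imports Defs "HOL-Combinatorics.Multiset_Permutations"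
begin

text \<open>
  Write \<open>\<pi> \<oplus> \<tau>\<close> for the permutation that acts as \<open>\<pi>\<close> on an initial segment and as a shifted
  copy of \<open>\<tau>\<close> on the rest. If the smallest entry of \<open>\<rho>\<close> stands at position \<open>k\<close> and \<open>\<rho>\<close> avoids
  312, then every entry before the 1 is below every entry after it: otherwise two such entries
  would form a 312 around the 1. Hence \<open>\<rho> = \<pi> \<oplus> \<tau>\<close>, where \<open>\<pi>\<close> has length \<open>k\<close> and ends in 1;
  call such a \<open>\<pi>\<close> a block.
  Squaring acts summandwise, \<open>(\<pi> \<oplus> \<tau>)\<^sup>2 = \<pi>\<^sup>2 \<oplus> \<tau>\<^sup>2\<close>. The patterns 312, 4321 and 231 all start above
  their last entry, so none of their occurrences can straddle the two summands. All conditions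
  therefore pass to the summands and back (\<open>dsum_counted_perms_iff\<close>), and splitting off the first
  block gives \<open>A = 1 + B A\<close> with \<open>B\<close> the generating function of the blocks
  (\<open>card_counted_perms_rec\<close>).

  It remains to see that \<open>B\<close> is the polynomial \<open>x + x\<^sup>2 + 2 x\<^sup>3 + 3 x\<^sup>4 + 2 x\<^sup>5\<close>. Because a block
  ends in its minimum, avoiding 4321 becomes avoiding 321 on the other entries; with 312 this
  means that an entry exceeds at most one later entry besides the final 1. So
  \<open>\<pi> i \<le> i + 2\<close>, and the maximum \<open>n\<close> stands at a position \<open>p \<ge> n - 2\<close>. Since
  \<open>\<pi>\<^sup>2 p = 1\<close>, avoiding 231 forces \<open>\<pi>\<^sup>2\<close> to decrease before position \<open>p\<close>. For \<open>n \<ge> 6\<close> this covers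
  positions 1, 2 and 3, where the values of \<open>\<pi>\<^sup>2\<close> are too small to allow it (\<open>blocks_empty\<close>). Lengths up
  to five are enumerated (\<open>card_blocks_small\<close>).
\<close>

section \<open>Pattern containment\<close>

lemma set_one_line: "set (one_line n \<pi>) = \<pi> ` {1..n}"
  by (simp add: one_line_def atLeastLessThanSuc_atLeastAtMost del: upt_Suc)

text \<open>
  Subsequences given by their positions, the form in which occurrences of a pattern are
  exhibited below.
\<close>

lemma contains_pattern_one_lineI:
  assumes "sorted_wrt (<) js" and "set js \<subseteq> {1..n}" and "same_relative_order (map \<pi> js) \<sigma>"
  shows "contains_pattern (one_line n \<pi>) \<sigma>"
proof -
  have "filter (\<lambda>i. i \<in> set js) [1..<Suc n] = js"
    by (intro strict_sorted_equal sorted_wrt_filter assms(1) sorted_wrt_upt) (use assms(2) in auto)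
  then have "subseq js [1..<Suc n]"
    by (metis subseq_filter_left)
  then show ?thesis
    using assms(3) subseq_map unfolding contains_pattern_def one_line_def by blast
qed

text \<open>
  The three patterns as explicit inequalities. Stating them by cases on the list, rather than
  only for lists of the right length, makes them usable for evaluation over all subsequences of a
  word.
\<close>

lemma same_relative_order_312:
  "same_relative_order s [3, 1, 2] \<longleftrightarrow> (case s of [a, b, c] \<Rightarrow> b < c \<and> c < a | _ \<Rightarrow> False)"
proof (cases "length s = 3")
  case True
  then obtain a b c where "s = [a, b, c]"
    by (auto simp: numeral_eq_Suc length_Suc_conv)
  then show ?thesis
    by (auto simp: same_relative_order_def numeral_eq_Suc All_less_Suc)
next
  case False
  then show ?thesis
    by (auto simp: same_relative_order_def split: list.split)
qed

lemma same_relative_order_231: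
  "same_relative_order s [2, 3, 1] \<longleftrightarrow> (case s of [a, b, c] \<Rightarrow> c < a \<and> a < b | _ \<Rightarrow> False)"
proof (cases "length s = 3")
  case True
  then obtain a b c where "s = [a, b, c]"
    by (auto simp: numeral_eq_Suc length_Suc_conv)
  then show ?thesis
    by (auto simp: same_relative_order_def numeral_eq_Suc All_less_Suc)
next
  case False
  then show ?thesis
    by (auto simp: same_relative_order_def split: list.split)
qed

lemma same_relative_order_4321:
  "same_relative_order s [4, 3, 2, 1] \<longleftrightarrow> (case s of [a, b, c, d] \<Rightarrow> d < c \<and> c < b \<and> b < a | _ \<Rightarrow> False)"
proof (cases "length s = 4")
  case True
  then obtain a b c d where "s = [a, b, c, d]"
    by (auto simp: numeral_eq_Suc length_Suc_conv)
  then show ?thesis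
    by (auto simp: same_relative_order_def numeral_eq_Suc All_less_Suc)
next
  case False
  then show ?thesis
    by (auto simp: same_relative_order_def split: list.split)
qed

lemma avoids_312D:
  assumes "avoids (one_line n \<pi>) [3, 1, 2]" "1 \<le> i" "i < j" "j < l" "l \<le> n"
  shows "\<not> (\<pi> j < \<pi> l \<and> \<pi> l < \<pi> i)"
  using contains_pattern_one_lineI[of "[i, j, l]" n \<pi> "[3, 1, 2]"] assms
  unfolding list.map same_relative_order_312 list.case by auto

lemma avoids_231D:
  assumes "avoids (one_line n \<pi>) [2, 3, 1]" "1 \<le> i" "i < j" "j < l" "l \<le> n"
  shows "\<not> (\<pi> l < \<pi> i \<and> \<pi> i < \<pi> j)"
  using contains_pattern_one_lineI[of "[i, j, l]" n \<pi> "[2, 3, 1]"] assms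
  unfolding list.map same_relative_order_231 list.case by auto

lemma avoids_4321D:
  assumes "avoids (one_line n \<pi>) [4, 3, 2, 1]" "1 \<le> h" "h < i" "i < j" "j < l" "l \<le> n"
  shows "\<not> (\<pi> l < \<pi> j \<and> \<pi> j < \<pi> i \<and> \<pi> i < \<pi> h)"
  using contains_pattern_one_lineI[of "[h, i, j, l]" n \<pi> "[4, 3, 2, 1]"] assms
  unfolding list.map same_relative_order_4321 list.case by auto

text \<open>
  For a permutation in one-line form this says that it is not a direct sum of two shorter
  ones. The witness pair at each cut is what an occurrence straddling two summands contradicts.
\<close>

definition sum_indecomposable :: "nat list \<Rightarrow> bool" where
  "sum_indecomposable \<sigma> \<longleftrightarrow>
     (\<forall>m. 0 < m \<and> m < length \<sigma> \<longrightarrow> (\<exists>i<m. \<exists>j. m \<le> j \<and> j < length \<sigma> \<and> \<not> \<sigma> ! i < \<sigma> ! j))"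

text \<open>
  Every cut separates the first entry from the last, so these two witness indecomposability at
  all cuts at once.
\<close>

lemma sum_indecomposableI:
  assumes "last \<sigma> < hd \<sigma>"
  shows "sum_indecomposable \<sigma>"
  unfolding sum_indecomposable_def
proof (intro allI impI)
  fix m assume m: "0 < m \<and> m < length \<sigma>"
  then have "\<sigma> \<noteq> []" by auto
  then have "\<not> \<sigma> ! 0 < \<sigma> ! (length \<sigma> - 1)"
    using assms by (simp add: hd_conv_nth last_conv_nth)
  then show "\<exists>i<m. \<exists>j. m \<le> j \<and> j < length \<sigma> \<and> \<not> \<sigma> ! i < \<sigma> ! j"
    using m by (intro exI[of _ 0] conjI exI[of _ "length \<sigma> - 1"]) auto
qed

text \<open>
  An occurrence using letters of both \<open>u\<close> and \<open>v\<close> would cut the pattern into two parts, the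
  first entirely below the second.
\<close>

lemma contains_pattern_append:
  assumes \<sigma>: "sum_indecomposable \<sigma>" and uv: "\<And>x y. x \<in> set u \<Longrightarrow> y \<in> set v \<Longrightarrow> x < y"
  shows "contains_pattern (u @ v) \<sigma> \<longleftrightarrow> contains_pattern u \<sigma> \<or> contains_pattern v \<sigma>"
proof
  assume "contains_pattern (u @ v) \<sigma>"
  then obtain s t where s: "subseq s u" and t: "subseq t v" and st: "same_relative_order (s @ t) \<sigma>"
    unfolding contains_pattern_def subseq_append_iff by blast
  have "s = [] \<or> t = []"
  proof (rule ccontr)
    assume "\<not> (s = [] \<or> t = [])"
    moreover have len: "length \<sigma> = length s + length t"
      using st by (simp add: same_relative_order_def)
    ultimately obtain i j where i: "i < length s" and j: "length s \<le> j" "j < length \<sigma>"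
      and ij: "\<not> \<sigma> ! i < \<sigma> ! j"
      using \<sigma>[unfolded sum_indecomposable_def, rule_format, of "length s"] by auto
    have "set s \<subseteq> set u" "set t \<subseteq> set v"
      using s t set_nths_subset by (force simp: subseq_conv_nths)+
    moreover have "j - length s < length t"
      using j len by simp
    ultimately have "s ! i \<in> set u" "t ! (j - length s) \<in> set v"
      using i nth_mem by blast+
    then have "s ! i < t ! (j - length s)"
      using uv by blast
    then have "(s @ t) ! i < (s @ t) ! j"
      using i j by (auto simp: nth_append)
    then show False
      using st i j ij len by (auto simp: same_relative_order_def)
  qed
  then show "contains_pattern u \<sigma> \<or> contains_pattern v \<sigma>"
    using s t st unfolding contains_pattern_def by auto
qed (auto simp: contains_pattern_def intro: list_emb_append2 subseq_order.trans)

lemma same_relative_order_map: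
  assumes "strict_mono f"
  shows "same_relative_order (map f s) \<sigma> \<longleftrightarrow> same_relative_order s \<sigma>"
  using strict_mono_less[OF assms] by (auto simp: same_relative_order_def)

lemma contains_pattern_map:
  assumes "strict_mono f"
  shows "contains_pattern (map f v) \<sigma> \<longleftrightarrow> contains_pattern v \<sigma>"
proof
  assume "contains_pattern (map f v) \<sigma>"
  then obtain N where "same_relative_order (nths (map f v) N) \<sigma>"
    unfolding contains_pattern_def subseq_conv_nths by auto
  then have "same_relative_order (nths v N) \<sigma>"
    by (simp add: nths_map same_relative_order_map[OF assms])
  then show "contains_pattern v \<sigma>"
    unfolding contains_pattern_def subseq_conv_nths by auto
next
  assume "contains_pattern v \<sigma>"
  then show "contains_pattern (map f v) \<sigma>"
    unfolding contains_pattern_def using same_relative_order_map[OF assms] subseq_map by blast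
qed

section \<open>Direct sums of permutations\<close>

text \<open>
  The direct sum \<open>\<pi> \<oplus> \<tau>\<close>. Only the length of \<open>\<pi>\<close> is a parameter: \<open>\<tau>\<close> fixes everything beyond its
  own length, so the shifted copy fixes everything beyond the total length.
\<close>

definition dsum :: "nat \<Rightarrow> (nat \<Rightarrow> nat) \<Rightarrow> (nat \<Rightarrow> nat) \<Rightarrow> nat \<Rightarrow> nat" where
  "dsum k \<pi> \<tau> i = (if i \<le> k then \<pi> i else \<tau> (i - k) + k)"

lemma permutes_le_iff:
  fixes \<pi> :: "nat \<Rightarrow> nat"
  assumes "\<pi> permutes {1..k}"
  shows "\<pi> i \<le> k \<longleftrightarrow> i \<le> k"
proof (cases "i \<in> {1..k}")
  case True
  then show ?thesis using permutes_in_image[OF assms, of i] by simp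
next
  case False
  then show ?thesis using permutes_not_in[OF assms, of i] by simp
qed

lemma permutes_pos:
  fixes \<tau> :: "nat \<Rightarrow> nat"
  assumes "\<tau> permutes {1..m}" "0 < i"
  shows "0 < \<tau> i"
  using permutes_in_image[OF assms(1), of i] permutes_not_in[OF assms(1), of i] assms(2)
  by (cases "i \<in> {1..m}") auto

lemma dsum_permutes:
  assumes "\<pi> permutes {1..k}" "\<tau> permutes {1..m}"
  shows "dsum k \<pi> \<tau> permutes {1..k + m}"
proof (rule bij_imp_permutes)
  have inj: "inj_on (dsum k \<pi> \<tau>) {1..k + m}"
  proof (rule inj_onI)
    fix i j assume ij: "i \<in> {1..k + m}" "j \<in> {1..k + m}" and eq: "dsum k \<pi> \<tau> i = dsum k \<pi> \<tau> j"
    have "i \<le> k \<longleftrightarrow> j \<le> k"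
      using eq permutes_le_iff[OF assms(1), of i] permutes_le_iff[OF assms(1), of j]
        permutes_pos[OF assms(2), of "i - k"] permutes_pos[OF assms(2), of "j - k"]
      by (auto simp: dsum_def split: if_splits)
    then show "i = j"
      using eq permutes_inj[OF assms(1)] permutes_inj[OF assms(2)]
      by (auto simp: dsum_def inj_eq split: if_splits)
  qed
  have "dsum k \<pi> \<tau> ` {1..k + m} \<subseteq> {1..k + m}"
  proof
    fix y assume "y \<in> dsum k \<pi> \<tau> ` {1..k + m}"
    then obtain i where i: "1 \<le> i" "i \<le> k + m" and y: "y = dsum k \<pi> \<tau> i" by auto
    show "y \<in> {1..k + m}"
      using i y permutes_le_iff[OF assms(1), of i] permutes_pos[OF assms(1), of i]
        permutes_le_iff[OF assms(2), of "i - k"] permutes_pos[OF assms(2), of "i - k"]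
      by (auto simp: dsum_def)
  qed
  with inj show "bij_betw (dsum k \<pi> \<tau>) {1..k + m} {1..k + m}"
    by (simp add: bij_betw_def endo_inj_surj)
next
  fix i assume i: "i \<notin> {1..k + m}"
  show "dsum k \<pi> \<tau> i = i"
  proof (cases "i \<le> k")
    case True
    then show ?thesis
      using i permutes_not_in[OF assms(1), of i] by (simp add: dsum_def)
  next
    case False
    with i have "i - k \<notin> {1..m}" by auto
    with False show ?thesis
      using permutes_not_in[OF assms(2), of "i - k"] by (simp add: dsum_def)
  qed
qed

text \<open>
  Both summands map their own segment to itself, so the second application meets the same
  branch as the first.
\<close>

lemma dsum_comp:
  assumes "\<pi> permutes {1..k}" "\<tau> permutes {1..m}"
  shows "dsum k \<pi> \<tau> \<circ> dsum k \<pi> \<tau> = dsum k (\<pi> \<circ> \<pi>) (\<tau> \<circ> \<tau>)"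
proof
  fix i
  show "(dsum k \<pi> \<tau> \<circ> dsum k \<pi> \<tau>) i = dsum k (\<pi> \<circ> \<pi>) (\<tau> \<circ> \<tau>) i"
    using permutes_le_iff[OF assms(1), of i] permutes_pos[OF assms(2), of "i - k"]
    by (auto simp: dsum_def)
qed

lemma one_line_dsum:
  "one_line (k + m) (dsum k \<pi> \<tau>) = one_line k \<pi> @ map (\<lambda>x. x + k) (one_line m \<tau>)"
proof -
  have "[1..<Suc (k + m)] = [1..<Suc k] @ map (\<lambda>i. i + k) [1..<Suc m]"
    by (rule nth_equalityI) (auto simp: nth_append simp del: upt_Suc)
  then show ?thesis
    by (simp add: one_line_def dsum_def comp_def del: upt_Suc)
qed

lemma contains_pattern_dsum:
  assumes "sum_indecomposable \<sigma>" "\<pi> permutes {1..k}" "\<tau> permutes {1..m}"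
  shows "contains_pattern (one_line (k + m) (dsum k \<pi> \<tau>)) \<sigma> \<longleftrightarrow>
    contains_pattern (one_line k \<pi>) \<sigma> \<or> contains_pattern (one_line m \<tau>) \<sigma>"
proof -
  have less: "x < y" if xy: "x \<in> set (one_line k \<pi>)" "y \<in> set (map (\<lambda>x. x + k) (one_line m \<tau>))" for x y
  proof -
    obtain i j where "i \<in> {1..k}" "x = \<pi> i" "j \<in> {1..m}" "y = \<tau> j + k"
      using xy unfolding set_map set_one_line by blast
    then show ?thesis
      using permutes_le_iff[OF assms(2), of i] permutes_pos[OF assms(3), of j] by simp
  qed
  have append: "contains_pattern (one_line k \<pi> @ map (\<lambda>x. x + k) (one_line m \<tau>)) \<sigma> \<longleftrightarrow>
      contains_pattern (one_line k \<pi>) \<sigma> \<or> contains_pattern (map (\<lambda>x. x + k) (one_line m \<tau>)) \<sigma>"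
    by (rule contains_pattern_append[OF assms(1) less])
  have "strict_mono (\<lambda>x::nat. x + k)"
    by (simp add: strict_mono_def)
  from contains_pattern_map[OF this] show ?thesis
    unfolding one_line_dsum append by simp
qed

lemma dsum_avoiders_iff:
  assumes "\<pi> permutes {1..k}" "\<tau> permutes {1..m}"
    and "\<And>\<sigma>. \<sigma> \<in> insert \<rho> T \<Longrightarrow> sum_indecomposable \<sigma>"
  shows "dsum k \<pi> \<tau> \<in> avoiders (k + m) T \<rho> \<longleftrightarrow> \<pi> \<in> avoiders k T \<rho> \<and> \<tau> \<in> avoiders m T \<rho>"
proof -
  have self: "contains_pattern (one_line (k + m) (dsum k \<pi> \<tau>)) \<sigma> \<longleftrightarrow>
      contains_pattern (one_line k \<pi>) \<sigma> \<or> contains_pattern (one_line m \<tau>) \<sigma>" if "\<sigma> \<in> T" for \<sigma>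
    using assms(3)[of \<sigma>] that by (intro contains_pattern_dsum assms(1,2)) simp
  have square: "contains_pattern (one_line (k + m) (dsum k \<pi> \<tau> \<circ> dsum k \<pi> \<tau>)) \<rho> \<longleftrightarrow>
      contains_pattern (one_line k (\<pi> \<circ> \<pi>)) \<rho> \<or> contains_pattern (one_line m (\<tau> \<circ> \<tau>)) \<rho>"
    unfolding dsum_comp[OF assms(1,2)]
    by (intro contains_pattern_dsum permutes_compose assms(1,2)) (simp add: assms(3))
  show ?thesis
    unfolding avoiders_def mem_Collect_eq square
    using assms(1,2) dsum_permutes[OF assms(1,2)] self by blast
qed

lemma dsum_inj:
  assumes "\<pi> permutes {1..k}" "\<pi>' permutes {1..k}" "\<tau> permutes {1..m}" "\<tau>' permutes {1..m}"
    and eq: "dsum k \<pi> \<tau> = dsum k \<pi>' \<tau>'"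
  shows "\<pi> = \<pi>' \<and> \<tau> = \<tau>'"
proof (intro conjI ext)
  fix i
  show "\<pi> i = \<pi>' i"
    using fun_cong[OF eq, of i] permutes_not_in[OF assms(1), of i] permutes_not_in[OF assms(2), of i]
    by (cases "i \<le> k") (auto simp: dsum_def)
  show "\<tau> i = \<tau>' i"
    using fun_cong[OF eq, of "i + k"] permutes_not_in[OF assms(3), of i]
      permutes_not_in[OF assms(4), of i]
    by (cases "i = 0") (auto simp: dsum_def)
qed

text \<open>
  A permutation preserving an initial segment is a direct sum: it also preserves the complementary
  segment, and the second summand is read off there.
\<close>

lemma dsum_split:
  assumes \<rho>: "\<rho> permutes {1..k + m}" and le: "\<And>i. i \<in> {1..k} \<Longrightarrow> \<rho> i \<le> k"
  obtains \<pi> \<tau> where "\<pi> permutes {1..k}" "\<tau> permutes {1..m}" "\<rho> = dsum k \<pi> \<tau>"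
proof -
  have "\<rho> ` {1..k} \<subseteq> {1..k}"
  proof (rule image_subsetI)
    fix i assume "i \<in> {1..k}"
    then show "\<rho> i \<in> {1..k}"
      using le[of i] permutes_pos[OF \<rho>, of i] by simp
  qed
  then have img: "\<rho> ` {1..k} = {1..k}"
    by (intro endo_inj_surj permutes_inj_on[OF \<rho>]) auto
  then have bij\<pi>: "bij_betw \<rho> {1..k} {1..k}"
    by (simp add: bij_betw_def permutes_inj_on[OF \<rho>])
  have gt: "k < \<rho> i" if "k < i" for i
  proof (rule ccontr)
    assume "\<not> k < \<rho> i"
    then have "\<rho> i \<in> \<rho> ` {1..k}"
      using img permutes_pos[OF \<rho>, of i] that by simp
    then have "i \<in> {1..k}"
      using permutes_inj[OF \<rho>] by (simp add: inj_image_mem_iff)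
    with that show False by simp
  qed
  \<comment> \<open>The case 0 is separate because \<open>\<rho> (0 + k)\<close> belongs to the first segment.\<close>
  define \<tau> where "\<tau> i = (if i = 0 then 0 else \<rho> (i + k) - k)" for i
  have "\<tau> permutes {1..m}"
  proof (rule bij_imp_permutes)
    have "inj_on \<tau> {1..m}"
    proof (rule inj_onI)
      fix i j assume "i \<in> {1..m}" "j \<in> {1..m}" "\<tau> i = \<tau> j"
      then have "\<rho> (i + k) = \<rho> (j + k)"
        using gt[of "i + k"] gt[of "j + k"] by (simp add: \<tau>_def)
      then show "i = j"
        using permutes_inj[OF \<rho>] by (simp add: inj_eq)
    qed
    moreover have "\<tau> ` {1..m} \<subseteq> {1..m}"
    proof
      fix y assume "y \<in> \<tau> ` {1..m}"
      then obtain i where "1 \<le> i" "i \<le> m" "y = \<tau> i" by auto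
      then show "y \<in> {1..m}"
        using gt[of "i + k"] permutes_le_iff[OF \<rho>, of "i + k"] by (auto simp: \<tau>_def)
    qed
    ultimately show "bij_betw \<tau> {1..m} {1..m}"
      by (simp add: bij_betw_def endo_inj_surj)
  next
    fix i assume "i \<notin> {1..m}"
    then show "\<tau> i = i"
      using permutes_not_in[OF \<rho>, of "i + k"] by (auto simp: \<tau>_def)
  qed
  moreover have "\<rho> = dsum k (restrict_id \<rho> {1..k}) \<tau>"
  proof
    fix i
    show "\<rho> i = dsum k (restrict_id \<rho> {1..k}) \<tau> i"
      using gt[of i] permutes_not_in[OF \<rho>, of i]
      by (auto simp: dsum_def \<tau>_def restrict_id_def)
  qed
  ultimately show thesis
    using that permutes_restrict_id[OF bij\<pi>] by blast
qed

section \<open>The block recurrence\<close>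

definition counted_perms :: "nat \<Rightarrow> (nat \<Rightarrow> nat) set" where
  "counted_perms n = avoiders n {[3, 1, 2], [4, 3, 2, 1]} [2, 3, 1]"

text \<open>
  The sum-indecomposable members of the class. For a permutation avoiding 312 indecomposability
  amounts to ending in 1, which is the more convenient condition. There is no block of length 0,
  since a permutation of the empty set fixes 0.
\<close>

definition blocks :: "nat \<Rightarrow> (nat \<Rightarrow> nat) set" where
  "blocks k = {\<pi> \<in> counted_perms k. \<pi> k = 1}"

lemma counted_permsD:
  assumes "\<pi> \<in> counted_perms n"
  shows "\<pi> permutes {1..n}" "avoids (one_line n \<pi>) [3, 1, 2]"
    "avoids (one_line n \<pi>) [4, 3, 2, 1]" "avoids (one_line n (\<pi> \<circ> \<pi>)) [2, 3, 1]"
  using assms by (auto simp: counted_perms_def avoiders_def)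

lemma finite_counted_perms: "finite (counted_perms n)"
  by (rule finite_subset[OF _ finite_permutations[of "{1..n}"]]) (auto simp: counted_perms_def avoiders_def)

text \<open>
  Entries at positions up to \<open>k\<close> lie below all entries after the 1, by avoidance of 312. So all
  values up to \<open>\<rho> i\<close> are taken within the first \<open>k\<close> positions, and there are at most \<open>k\<close> of them.
\<close>

lemma first_block_le:
  assumes \<rho>: "\<rho> permutes {1..n}" "avoids (one_line n \<rho>) [3, 1, 2]"
    and k: "k \<in> {1..n}" "\<rho> k = 1" and i: "i \<in> {1..k}"
  shows "\<rho> i \<le> k"
proof -
  have less: "\<rho> i < \<rho> j" if "k < j" "j \<le> n" for j
  proof -
    have "1 < \<rho> j"
      using that permutes_pos[OF \<rho>(1), of j] k(2) permutes_inj[OF \<rho>(1), THEN injD, of j k]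
      by (cases "\<rho> j = 1") auto
    moreover have "\<rho> i \<noteq> \<rho> j"
      using permutes_inj[OF \<rho>(1), THEN injD, of i j] that i by auto
    ultimately show ?thesis
      using avoids_312D[OF \<rho>(2), of i k j] i that k by (cases "i = k") auto
  qed
  have "{1..\<rho> i} \<subseteq> \<rho> ` {1..k}"
  proof
    fix v assume v: "v \<in> {1..\<rho> i}"
    then have "v \<in> \<rho> ` {1..n}"
      using permutes_image[OF \<rho>(1)] permutes_in_image[OF \<rho>(1), of i] i k by auto
    then obtain j where "j \<in> {1..n}" "v = \<rho> j" by auto
    then show "v \<in> \<rho> ` {1..k}"
      using less[of j] v by (cases "j \<le> k") auto
  qed
  from card_mono[OF _ this] have "\<rho> i \<le> card (\<rho> ` {1..k})" by simp
  also have "\<dots> \<le> k" using card_image_le[of "{1..k}" \<rho>] by simp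
  finally show ?thesis .
qed

lemma dsum_counted_perms_iff:
  assumes "\<pi> permutes {1..k}" "\<tau> permutes {1..m}"
  shows "dsum k \<pi> \<tau> \<in> counted_perms (k + m) \<longleftrightarrow> \<pi> \<in> counted_perms k \<and> \<tau> \<in> counted_perms m"
  unfolding counted_perms_def by (rule dsum_avoiders_iff[OF assms]) (auto intro!: sum_indecomposableI)

text \<open>
  Position \<open>k\<close> of the 1 is the length of the first block, and what follows is an arbitrary shorter
  member of the class.
\<close>

lemma counted_perms_first_block:
  assumes k: "k \<in> {1..n}"
  shows "{\<rho> \<in> counted_perms n. \<rho> k = 1} = (\<lambda>(\<pi>, \<tau>). dsum k \<pi> \<tau>) ` (blocks k \<times> counted_perms (n - k))"
proof (intro equalityI subsetI)
  fix \<rho> assume \<rho>: "\<rho> \<in> {\<rho> \<in> counted_perms n. \<rho> k = 1}"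
  then have "\<rho> permutes {1..k + (n - k)}"
    using k counted_permsD(1)[of \<rho> n] by simp
  moreover have "\<rho> i \<le> k" if "i \<in> {1..k}" for i
    using first_block_le[OF counted_permsD(1,2)] \<rho> k that by blast
  ultimately obtain \<pi> \<tau> where p: "\<pi> permutes {1..k}" "\<tau> permutes {1..n - k}" "\<rho> = dsum k \<pi> \<tau>"
    by (rule dsum_split)
  then have "\<pi> \<in> counted_perms k \<and> \<tau> \<in> counted_perms (n - k)"
    using \<rho> k dsum_counted_perms_iff[OF p(1,2)] by simp
  moreover have "\<pi> k = 1"
    using \<rho> p(3) by (simp add: dsum_def)
  ultimately show "\<rho> \<in> (\<lambda>(\<pi>, \<tau>). dsum k \<pi> \<tau>) ` (blocks k \<times> counted_perms (n - k))"
    using p(3) by (auto simp: blocks_def)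
next
  fix \<rho> assume "\<rho> \<in> (\<lambda>(\<pi>, \<tau>). dsum k \<pi> \<tau>) ` (blocks k \<times> counted_perms (n - k))"
  then obtain \<pi> \<tau> where p: "\<pi> \<in> counted_perms k" "\<pi> k = 1" "\<tau> \<in> counted_perms (n - k)" "\<rho> = dsum k \<pi> \<tau>"
    by (auto simp: blocks_def)
  then show "\<rho> \<in> {\<rho> \<in> counted_perms n. \<rho> k = 1}"
    using k dsum_counted_perms_iff[OF counted_permsD(1)[OF p(1)] counted_permsD(1)[OF p(3)]]
    by (simp add: dsum_def)
qed

lemma card_counted_perms_first_block:
  assumes "k \<in> {1..n}"
  shows "card {\<rho> \<in> counted_perms n. \<rho> k = 1} = card (blocks k) * card (counted_perms (n - k))"
proof -
  have "inj_on (\<lambda>(\<pi>, \<tau>). dsum k \<pi> \<tau>) (blocks k \<times> counted_perms (n - k))"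
  proof (rule inj_onI, clarify)
    fix \<pi> \<tau> \<pi>' \<tau>'
    assume "\<pi> \<in> blocks k" "\<pi>' \<in> blocks k" "\<tau> \<in> counted_perms (n - k)" "\<tau>' \<in> counted_perms (n - k)"
      and "dsum k \<pi> \<tau> = dsum k \<pi>' \<tau>'"
    then show "\<pi> = \<pi>' \<and> \<tau> = \<tau>'"
      by (intro dsum_inj) (auto simp: blocks_def dest: counted_permsD(1) simp del: One_nat_def)
  qed
  then show ?thesis
    unfolding counted_perms_first_block[OF assms] by (simp add: card_image card_cartesian_product)
qed

lemma card_counted_perms_rec:
  assumes "0 < n"
  shows "card (counted_perms n) = (\<Sum>k\<in>{1..n}. card (blocks k) * card (counted_perms (n - k)))"
proof -
  have "counted_perms n = (\<Union>k\<in>{1..n}. {\<rho> \<in> counted_perms n. \<rho> k = 1})"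
  proof (intro equalityI subsetI)
    fix \<rho> assume \<rho>: "\<rho> \<in> counted_perms n"
    then have "1 \<in> \<rho> ` {1..n}"
      using permutes_image[OF counted_permsD(1)] assms by auto
    then show "\<rho> \<in> (\<Union>k\<in>{1..n}. {\<rho> \<in> counted_perms n. \<rho> k = 1})"
      using \<rho> by auto
  qed auto
  also have "card \<dots> = (\<Sum>k\<in>{1..n}. card {\<rho> \<in> counted_perms n. \<rho> k = 1})"
  proof (rule card_UN_disjoint)
    show "\<forall>i\<in>{1..n}. \<forall>j\<in>{1..n}. i \<noteq> j \<longrightarrow>
        {\<rho> \<in> counted_perms n. \<rho> i = 1} \<inter> {\<rho> \<in> counted_perms n. \<rho> j = 1} = {}"
    proof (intro ballI impI)
      fix i j :: nat assume "i \<noteq> j"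
      then show "{\<rho> \<in> counted_perms n. \<rho> i = 1} \<inter> {\<rho> \<in> counted_perms n. \<rho> j = 1} = {}"
        using permutes_inj[OF counted_permsD(1), THEN injD, of _ n i j] by fastforce
    qed
  qed (auto simp: finite_counted_perms)
  finally show ?thesis
    by (simp only: card_counted_perms_first_block cong: sum.cong)
qed

section \<open>Blocks of size at least six\<close>

text \<open>
  Two later entries below \<open>\<pi> i\<close> form a 312 with it if they increase; if they decrease, they
  form a 4321 with it and the final 1.
\<close>

lemma block_at_most_one_smaller_later:
  assumes "\<pi> \<in> blocks n" and "1 \<le> i" "i < j" "j < l" "l < n"
  shows "\<not> (\<pi> j < \<pi> i \<and> \<pi> l < \<pi> i)"
proof
  assume smaller: "\<pi> j < \<pi> i \<and> \<pi> l < \<pi> i"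
  have \<pi>: "\<pi> \<in> counted_perms n" "\<pi> n = 1"
    using assms(1) by (auto simp: blocks_def)
  note perm = counted_permsD(1)[OF \<pi>(1)]
  have "\<pi> l \<noteq> \<pi> j" "\<pi> l \<noteq> 1"
    using permutes_inj[OF perm, THEN injD, of l j] permutes_inj[OF perm, THEN injD, of l n]
      assms \<pi>(2) by auto
  then have "\<pi> n < \<pi> l"
    using permutes_pos[OF perm, of l] assms \<pi>(2) by linarith
  show False
  proof (cases "\<pi> j < \<pi> l")
    case True
    then show ?thesis
      using avoids_312D[OF counted_permsD(2)[OF \<pi>(1)], of i j l] assms smaller by simp
  next
    case False
    then show ?thesis
      using avoids_4321D[OF counted_permsD(3)[OF \<pi>(1)], of i j l n] assms smaller
        \<open>\<pi> l \<noteq> \<pi> j\<close> \<open>\<pi> n < \<pi> l\<close> by simp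
  qed
qed

text \<open>
  The values below \<open>\<pi> i\<close> are taken at the \<open>i - 1\<close> earlier positions, at the end of the block, and at
  no more than one further position.
\<close>

lemma block_le_add_two:
  assumes \<pi>: "\<pi> \<in> blocks n" and i: "1 \<le> i" "i < n"
  shows "\<pi> i \<le> i + 2"
proof -
  have perm: "\<pi> permutes {1..n}"
    using \<pi> counted_permsD(1) by (auto simp: blocks_def)
  define J where "J = {j. i < j \<and> j < n \<and> \<pi> j < \<pi> i}"
  have "card J \<le> 1"
  proof -
    have "j = l" if "j \<in> J" "l \<in> J" for j l
      using block_at_most_one_smaller_later[OF \<pi> i(1), of j l]
        block_at_most_one_smaller_later[OF \<pi> i(1), of l j] that
      by (cases j l rule: linorder_cases) (auto simp: J_def)
    moreover have "finite J" by (simp add: J_def)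
    ultimately show ?thesis by (simp add: card_le_Suc0_iff_eq)
  qed
  have "{1..<\<pi> i} \<subseteq> \<pi> ` ({1..<i} \<union> {n} \<union> J)"
  proof
    fix v assume v: "v \<in> {1..<\<pi> i}"
    have "\<pi> i \<le> n" using permutes_in_image[OF perm, of i] i by simp
    then have "v \<in> \<pi> ` {1..n}" using v permutes_image[OF perm] by auto
    then obtain j where j: "j \<in> {1..n}" "v = \<pi> j" by auto
    moreover have "j \<noteq> i" using v j by auto
    ultimately have "j \<in> {1..<i} \<union> {n} \<union> J"
      using v by (auto simp: J_def)
    then show "v \<in> \<pi> ` ({1..<i} \<union> {n} \<union> J)"
      using j by blast
  qed
  then have "card {1..<\<pi> i} \<le> card (\<pi> ` ({1..<i} \<union> {n} \<union> J))"
    by (intro card_mono) (auto simp: J_def)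
  also have "\<dots> \<le> card ({1..<i} \<union> {n} \<union> J)"
    by (intro card_image_le) (auto simp: J_def)
  also have "\<dots> \<le> card {1..<i} + card {n} + card J"
    by (metis (no_types, lifting) add_le_mono1 card_Un_le le_trans)
  also have "\<dots> \<le> (i - 1) + 1 + 1"
    using \<open>card J \<le> 1\<close> by simp
  finally show ?thesis using i by simp
qed

text \<open>
  The square must decrease strictly on positions 1, 2, 3 and stay above 1 there, but
  \<open>\<pi> 1 \<le> 3\<close>, \<open>\<pi> 2 \<le> 4\<close>, \<open>\<pi> 3 \<le> 5\<close> leave too little room. The bound \<open>6 \<le> n\<close>
  puts the maximum at position 4 or later, so that all three positions precede it.
\<close>

lemma blocks_empty:
  assumes "6 \<le> n"
  shows "blocks n = {}"
proof (rule ccontr)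
  assume "blocks n \<noteq> {}"
  then obtain \<pi> where b: "\<pi> \<in> blocks n" by blast
  then have \<pi>: "\<pi> \<in> counted_perms n" "\<pi> n = 1" by (auto simp: blocks_def)
  note perm = counted_permsD(1)[OF \<pi>(1)]
  have eq_iff: "\<pi> i = \<pi> j \<longleftrightarrow> i = j" for i j
    using permutes_inj[OF perm] by (simp add: inj_eq)
  have pos: "1 < \<pi> i" if "1 \<le> i" "i < n" for i
    using permutes_pos[OF perm, of i] eq_iff[of i n] \<pi>(2) that by fastforce
  have "n \<in> \<pi> ` {1..n}" using permutes_image[OF perm] assms by auto
  then obtain p where p: "p \<in> {1..n}" "\<pi> p = n" by auto
  have less_n: "\<pi> i < n" if "1 \<le> i" "i \<le> n" "i \<noteq> p" for i
    using permutes_in_image[OF perm, of i] eq_iff[of i p] p that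
    by (simp add: order.not_eq_order_implies_strict)
  \<comment> \<open>Otherwise the entries at \<open>p + 1\<close> and \<open>p + 2\<close>, neither of them final, are both below the maximum.\<close>
  have "4 \<le> p"
  proof (rule ccontr)
    assume "\<not> 4 \<le> p"
    then show False
      using block_at_most_one_smaller_later[OF b, of p "p + 1" "p + 2"] p assms
        less_n[of "p + 1"] less_n[of "p + 2"] by auto
  qed
  \<comment> \<open>An ascent of the square before position \<open>p\<close> is completed to a 231 by its value 1 at \<open>p\<close>.\<close>
  have dec: "\<pi> (\<pi> j) < \<pi> (\<pi> i)" if "1 \<le> i" "i < j" "j < p" for i j
  proof -
    have "\<pi> i \<in> {1..n}" using permutes_in_image[OF perm, of i] that p by simp
    then have "1 < \<pi> (\<pi> i)"
      using pos[of "\<pi> i"] eq_iff[of i p] p that by fastforce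
    then show ?thesis
      using avoids_231D[OF counted_permsD(4)[OF \<pi>(1)], of i j p] that p \<pi>(2) eq_iff[of "\<pi> i" "\<pi> j"] eq_iff[of i j]
      by (auto simp: not_less le_less)
  qed
  have d12: "\<pi> (\<pi> 2) < \<pi> (\<pi> 1)" and d23: "\<pi> (\<pi> 3) < \<pi> (\<pi> 2)"
    using dec[of 1 2] dec[of 2 3] \<open>4 \<le> p\<close> by auto
  have "\<pi> 3 < n" using less_n[of 3] \<open>4 \<le> p\<close> p by simp
  then have g3: "1 < \<pi> (\<pi> 3)" using pos[of "\<pi> 3"] pos[of 3] assms by simp
  have bounds: "1 < \<pi> 1" "\<pi> 1 \<le> 3" "1 < \<pi> 2" "\<pi> 2 \<le> 4" "1 < \<pi> 3" "\<pi> 3 \<le> 5"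
    using pos[of 1] pos[of 2] pos[of 3] assms block_le_add_two[OF b, of 1]
      block_le_add_two[OF b, of 2] block_le_add_two[OF b, of 3]
    by auto
  consider "\<pi> 1 = 2" | "\<pi> 1 = 3" using bounds by linarith
  then show False
  proof cases
    case 1
    then have "\<pi> 2 = 4" "\<pi> (\<pi> 3) = 2" using d12 d23 g3 bounds by auto
    then have "\<pi> 3 = 1" using 1 eq_iff[of "\<pi> 3" 1] by simp
    then show False using bounds by simp
  next
    case 2
    have "\<pi> 2 \<noteq> 2" using d23 g3 by auto
    moreover have "\<pi> 2 \<noteq> 3" using 2 eq_iff[of 2 1] by simp
    ultimately have "\<pi> 2 = 4" using bounds by linarith
    have "\<pi> 3 \<noteq> 3" "\<pi> 3 \<noteq> 4" using 2 \<open>\<pi> 2 = 4\<close> eq_iff[of 3 1] eq_iff[of 3 2] by auto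
    have "3 \<le> \<pi> 4" "\<pi> 4 < \<pi> 3" using 2 \<open>\<pi> 2 = 4\<close> d12 d23 g3 by auto
    then have "\<pi> 3 = 5" using \<open>\<pi> 3 \<noteq> 3\<close> \<open>\<pi> 3 \<noteq> 4\<close> bounds by linarith
    then have "\<pi> 4 = 3 \<or> \<pi> 4 = 4" using \<open>3 \<le> \<pi> 4\<close> \<open>\<pi> 4 < \<pi> 3\<close> by linarith
    then show False using 2 \<open>\<pi> 2 = 4\<close> eq_iff[of 4 1] eq_iff[of 4 2] by auto
  qed
qed

section \<open>Blocks of size at most five\<close>

lemma contains_pattern_code:
  "contains_pattern w \<sigma> \<longleftrightarrow> (\<exists>s\<in>set (subseqs w). same_relative_order s \<sigma>)"
  by (auto simp: contains_pattern_def)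

text \<open>
  One-line notation is injective on permutations, and the image is everything because both
  sides have \<open>n!\<close> elements.
\<close>

lemma one_line_permutations:
  "bij_betw (one_line n) {\<pi>. \<pi> permutes {1..n}} (permutations_of_set {1..n})"
proof -
  have inj: "inj_on (one_line n) {\<pi>. \<pi> permutes {1..n}}"
  proof (rule inj_onI, rule ext)
    fix \<pi> \<rho> i
    assume "\<pi> \<in> {\<pi>. \<pi> permutes {1..n}}" "\<rho> \<in> {\<pi>. \<pi> permutes {1..n}}"
      and eq: "one_line n \<pi> = one_line n \<rho>"
    then show "\<pi> i = \<rho> i"
      by (cases "i \<in> {1..n}") (auto simp: one_line_def permutes_not_in simp del: upt_Suc)
  qed
  have "one_line n ` {\<pi>. \<pi> permutes {1..n}} = permutations_of_set {1..n}"
  proof (rule card_subset_eq)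
    show "one_line n ` {\<pi>. \<pi> permutes {1..n}} \<subseteq> permutations_of_set {1..n}"
    proof
      fix w assume "w \<in> one_line n ` {\<pi>. \<pi> permutes {1..n}}"
      then obtain \<pi> where \<pi>: "\<pi> permutes {1..n}" and w: "w = map \<pi> [1..<Suc n]"
        by (auto simp: one_line_def)
      have s: "set [1..<Suc n] = {1..n}" by auto
      have "set w = {1..n}"
        unfolding w set_map s by (rule permutes_image[OF \<pi>])
      moreover have "distinct w"
        unfolding w distinct_map by (simp add: permutes_inj_on[OF \<pi>] del: upt_Suc)
      ultimately show "w \<in> permutations_of_set {1..n}"
        by (rule permutations_of_setI)
    qed
    show "card (one_line n ` {\<pi>. \<pi> permutes {1..n}}) = card (permutations_of_set {1..n})"
      unfolding card_image[OF inj] by (simp add: card_permutations)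
  qed simp
  with inj show ?thesis by (simp add: bij_betw_def)
qed

lemma one_line_square:
  assumes "\<pi> permutes {1..n}"
  shows "one_line n (\<pi> \<circ> \<pi>) = (let w = one_line n \<pi> in map (\<lambda>v. w ! (v - 1)) w)"
proof -
  have "one_line n \<pi> ! (\<pi> i - 1) = \<pi> (\<pi> i)" if "i \<in> {1..n}" for i
  proof -
    have "\<pi> i \<in> {1..n}"
      using that permutes_in_image[OF assms] by simp
    then show ?thesis
      by (auto simp: one_line_def nth_map simp del: upt_Suc)
  qed
  then show ?thesis
    by (simp add: one_line_def Let_def del: upt_Suc)
qed

text \<open>
  The one-line forms of the blocks, as an executable list. The condition on the last letter comes
  first, so that the patterns are tested only on the words that pass it.
\<close>

definition block_words :: "nat \<Rightarrow> nat list list" where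
  "block_words n =
     filter (\<lambda>w. avoids w [3, 1, 2] \<and> avoids w [4, 3, 2, 1] \<and>
         avoids (map (\<lambda>v. w ! (v - 1)) w) [2, 3, 1])
       (filter (\<lambda>w. last w = 1) (permutations_of_set_list [1..<Suc n]))"

lemma card_blocks_eq_block_words:
  assumes "0 < n"
  shows "card (blocks n) = length (block_words n)"
proof -
  have perms: "permutations_of_set {1..n} = set (permutations_of_set_list [1..<Suc n])"
    using permutations_of_list[of "[1..<Suc n]"]
    by (simp add: distinct_remdups_id atLeastLessThanSuc_atLeastAtMost del: upt_Suc)
  have "one_line n ` blocks n = set (block_words n)"
  proof -
    have last: "last (one_line n \<pi>) = \<pi> n" for \<pi>
      using assms by (simp add: one_line_def)
    have "one_line n ` blocks n = {w \<in> one_line n ` {\<pi>. \<pi> permutes {1..n}}. last w = 1 \<and>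
        avoids w [3, 1, 2] \<and> avoids w [4, 3, 2, 1] \<and> avoids (map (\<lambda>v. w ! (v - 1)) w) [2, 3, 1]}"
      by (auto simp: blocks_def counted_perms_def avoiders_def one_line_square last Let_def)
    also have "one_line n ` {\<pi>. \<pi> permutes {1..n}} = set (permutations_of_set_list [1..<Suc n])"
      using one_line_permutations[of n] perms by (simp add: bij_betw_def)
    finally show ?thesis
      by (auto simp: block_words_def)
  qed
  moreover have "inj_on (one_line n) (blocks n)"
    by (rule inj_on_subset[OF bij_betw_imp_inj_on[OF one_line_permutations]])
      (auto simp: blocks_def counted_perms_def avoiders_def)
  moreover have "distinct (block_words n)"
    unfolding block_words_def by (intro distinct_filter distinct_permutations_of_set_list) simp
  ultimately show ?thesis
    by (metis card_image distinct_card)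
qed

lemma card_blocks_small:
  "card (blocks 1) = 1" "card (blocks 2) = 1" "card (blocks 3) = 2"
  "card (blocks 4) = 3" "card (blocks 5) = 2"
proof -
  have "length (block_words 1) = 1 \<and> length (block_words 2) = 1 \<and> length (block_words 3) = 2 \<and>
    length (block_words 4) = 3 \<and> length (block_words 5) = 2"
    unfolding block_words_def contains_pattern_code same_relative_order_312
      same_relative_order_231 same_relative_order_4321
    by code_simp
  then show "card (blocks 1) = 1" "card (blocks 2) = 1" "card (blocks 3) = 2"
    "card (blocks 4) = 3" "card (blocks 5) = 2"
    by (simp_all add: card_blocks_eq_block_words)
qed

section \<open>The generating function\<close>

lemma blocks_0: "blocks 0 = {}"
  using permutes_not_in[OF counted_permsD(1), of _ 0 0] by (fastforce simp: blocks_def)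

lemma blocks_fps:
  "Abs_fps (\<lambda>k. of_nat (card (blocks k))) =
     (fps_X + fps_X^2 + 2 * fps_X^3 + 3 * fps_X^4 + 2 * fps_X^5 :: rat fps)"
proof (rule fps_ext)
  fix k :: nat
  consider "k = 0" | "k = 1" | "k = 2" | "k = 3" | "k = 4" | "k = 5" | "6 \<le> k" by linarith
  then show "fps_nth (Abs_fps (\<lambda>k. of_nat (card (blocks k)))) k =
     fps_nth (fps_X + fps_X^2 + 2 * fps_X^3 + 3 * fps_X^4 + 2 * fps_X^5 :: rat fps) k"
    by cases (use card_blocks_small in \<open>simp_all add: blocks_0 blocks_empty numeral_fps_const fps_X_power_iff\<close>)
qed

lemma card_counted_perms_0: "card (counted_perms 0) = 1"
proof -
  have "counted_perms 0 = {id}"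
    by (auto simp: counted_perms_def avoiders_def one_line_def contains_pattern_def same_relative_order_def)
  then show ?thesis by simp
qed

theorem theorem4p4:
  "(Abs_fps (\<lambda>n. of_nat (num_avoiders n {[3,1,2], [4,3,2,1]} [2,3,1])) :: rat fps) =
     1 / (1 - fps_X - fps_X^2 - 2 * fps_X^3 - 3 * fps_X^4 - 2 * fps_X^5)"
proof -
  define A where "A = (Abs_fps (\<lambda>n. of_nat (card (counted_perms n))) :: rat fps)"
  define B where "B = (Abs_fps (\<lambda>k. of_nat (card (blocks k))) :: rat fps)"
  \<comment> \<open>The 1 accounts for the empty permutation, the product for splitting off the first block.\<close>
  have "A = 1 + B * A"
  proof (rule fps_ext)
    fix n
    show "fps_nth A n = fps_nth (1 + B * A) n"
    proof (cases "n = 0")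
      case True
      then show ?thesis by (simp add: A_def B_def card_counted_perms_0 blocks_0)
    next
      case False
      then have "fps_nth A n = (\<Sum>k\<in>{1..n}. fps_nth B k * fps_nth A (n - k))"
        by (simp add: A_def B_def card_counted_perms_rec)
      also have "\<dots> = (\<Sum>k\<in>{0..n}. fps_nth B k * fps_nth A (n - k))"
        by (rule sum.mono_neutral_left) (auto simp: B_def blocks_0 not_less_eq_eq)
      finally show ?thesis using False by (simp add: fps_mult_nth)
    qed
  qed
  then have "(1 - B) * A = 1" by (simp add: algebra_simps)
  then have "A = inverse (1 - B)" by (simp add: fps_inverse_unique)
  also have "\<dots> = 1 / (1 - B)" by (simp add: fps_divide_unit B_def blocks_0)
  finally show ?thesis
    unfolding A_def B_def blocks_fps num_avoiders_def counted_perms_def by (simp add: algebra_simps)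
qed

end
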